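(* There is an absolute constant $c>0$ such that for any positive integer $N$ the set $$\Bigl\{n^4 : n\in\mathbb{N},\ N\le n\le N+cN^{3/5}\Bigr\}$$ is a Sidon set.
   Context: $\mathbb{N}$ denotes the positive integers. A set $\mathcal{A}$ of integers is called a Sidon set if the equation $a_1+a_2=a_3+a_4$ with $a_1,a_2,a_3,a_4\in\mathcal{A}$ has only trivial solutions, i.e. every solution satisfies $\{a_1,a_2\}=\{a_3,a_4\}$. *)

theory Defs
  imports Complex_Main
begin

(* For unordered pairs, equality of the sets {a1, a2} and {a3, a4} coincides with
   equality as multisets, also when a1 = a2. *)
definition sidon :: "int set \<Rightarrow> bool" where
  "sidon A \<longleftrightarrow>
     (\<forall>a1\<in>A. \<forall>a2\<in>A. \<forall>a3\<in>A. \<forall>a4\<in>A. a1 + a2 = a3 + a4 \<longrightarrow> {a1, a2} = {a3, a4})"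

end

theory Submission
  imports Defs
begin

text \<open>
  The proof is elementary. Suppose \<open>a^4 + b^4 = c^4 + d^4\<close> with all four integers in
  \<open>[N, N + H]\<close>. If \<open>a + b = c + d\<close>, then the solution is trivial
  (\<open>fourth_powers_equal_sum_trivial\<close>). Otherwise let \<open>a + b < c + d\<close>, put
  \<open>S = (c + d) + (a + b)\<close>, \<open>s = (c + d) - (a + b)\<close>, \<open>R = (a - b) + (c - d)\<close>,
  \<open>r = (a - b) - (c - d)\<close>, and measure by \<open>J = 3rR - sS\<close> how far the equation is from its
  leading-order form \<open>3rR = sS\<close>. In these variables the equation is exactly
  \<open>(8sS - J)(r^2 + R^2) = 3J(S^2 + s^2)\<close>, which is \<open>fourth_powers_factorization\<close>. Comparing
  signs gives \<open>J > 0\<close>. Since \<open>8sS\<close> is congruent to \<open>J\<close> modulo \<open>D = 8sS - J\<close>, the large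
  number \<open>S\<close> can be eliminated: \<open>D\<close> divides \<open>3J(J^2 + 64s^4)\<close>
  (\<open>eliminate_modulo_linear_factor\<close>).

  It remains to compare sizes. Let \<open>T = H^2 / N\<close>. From \<open>J > 0\<close> and \<open>\<bar>rR\<bar> \<le> H^2\<close> one gets
  \<open>s \<lless> T\<close>, and the equation above gives \<open>J \<lless> sT\<close>, whereas \<open>D\<close> is at least of order
  \<open>sN\<close>. A positive multiple of \<open>D\<close> is not smaller than \<open>D\<close>, hence
  \<open>sN \<lless> sT(s^2 T^2 + s^4) \<lless> s T^5\<close>. Thus \<open>N \<lless> T^5\<close>, which says that \<open>H\<close> is at least of
  order \<open>N powr (3/5)\<close>. With explicit constants, \<open>H = N powr (3/5) / 2\<close> is small enough for a
  contradiction.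
\<close>

text \<open>
  For a fixed sum \<open>x\<close>, the sum of fourth powers is \<open>x^4 - 4x^2 p + 2p^2\<close> with \<open>p\<close> the product,
  and this is strictly decreasing in \<open>p\<close> on the range \<open>p \<le> x^2 / 4\<close> of possible products.
\<close>
lemma fourth_powers_equal_sum_trivial:
  fixes a b c d :: int
  assumes eq: "a^4 + b^4 = c^4 + d^4" and sum: "a + b = c + d"
  shows "{a, b} = {c, d}"
proof -
  have d: "d = a + b - c" using sum by simp
  have "(a*b - c*d) * (2 * (a + b)^2 - a*b - c*d) = 0"
    using eq unfolding d by algebra
  then consider "a*b = c*d" | "2 * (a + b)^2 = a*b + c*d" by auto
  then have "a*b = c*d"
  proof cases
    case 2
    have "4 * (a*b) \<le> (a + b)^2"
      using zero_le_power2[of "a - b"] by (simp add: power2_eq_square algebra_simps)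
    moreover have "4 * (c*d) \<le> (a + b)^2"
      unfolding sum using zero_le_power2[of "c - d"]
      by (simp add: power2_eq_square algebra_simps)
    moreover have "(a + b)^2 \<ge> 0" by simp
    ultimately show ?thesis using 2 by linarith
  qed simp
  then have "(a - c) * (a - d) = 0" unfolding d by algebra
  then have "a = c \<or> a = d" by simp
  then show ?thesis using sum by auto
qed

text \<open>
  With \<open>x = a + b\<close> and \<open>u = a - b\<close> one has \<open>8 (a^4 + b^4) = (x^2 + 3 u^2)^2 - 8 u^4\<close>, so
  differences of squares factor the equation over \<open>S\<close>, \<open>s\<close>, \<open>R\<close>, \<open>r\<close>. Eliminating the
  product \<open>3 * r * R\<close> in favour of \<open>J\<close> leaves a relation that is linear in \<open>r^2 + R^2\<close>;
  this is what makes a divisibility argument possible.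
\<close>
lemma fourth_powers_factorization:
  fixes a b c d :: int
  assumes eq: "a^4 + b^4 = c^4 + d^4"
    and S: "S = c + d + a + b" and s: "s = c + d - a - b"
    and R: "R = a - b + (c - d)" and r: "r = a - b - (c - d)"
    and J: "J = 3 * r * R - s * S"
  shows "(8 * s * S - J) * (r^2 + R^2) = 3 * J * (S^2 + s^2)"
  using eq unfolding J S s R r by algebra

text \<open>
  Modulo \<open>D = 8 * s * S - J\<close> the number \<open>8 * s * S\<close> may be replaced by \<open>J\<close>. Multiplying
  \<open>3 * J * (S^2 + s^2)\<close> by \<open>64 * s^2\<close> makes \<open>S\<close> occur only through \<open>8 * s * S\<close>.
\<close>
lemma eliminate_modulo_linear_factor:
  fixes s S J Q :: int
  assumes "(8 * s * S - J) * Q = 3 * J * (S^2 + s^2)"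
  shows "(8 * s * S - J) dvd 3 * J * (J^2 + 64 * s^4)"
proof -
  have "3 * J * (J^2 + 64 * s^4)
      = (8 * s * S - J) * (64 * s^2 * Q - 3 * J * (8 * s * S + J))"
    using assms by algebra
  then show ?thesis by simp
qed

text \<open>
  The hypotheses say that \<open>T\<close> is at least \<open>H^2 / N\<close> and that \<open>T^5\<close> is small compared with
  \<open>N\<close>. If \<open>a + b < c + d\<close> held, then the divisor \<open>8 * s * S - J\<close> would be larger than the
  positive number \<open>3 * J * (J^2 + 64 * s^4)\<close> that it divides.
\<close>
lemma fourth_powers_short_interval_sum_not_less:
  fixes a b c d :: int and N H T :: real
  assumes N: "N \<ge> 1" and T: "T \<ge> 0" "1024 * T^5 \<le> N" and H: "H^2 \<le> T * N"
    and lo: "N \<le> a" "N \<le> b" "N \<le> c" "N \<le> d"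
    and hi: "a \<le> N + H" "b \<le> N + H" "c \<le> N + H" "d \<le> N + H"
    and eq: "a^4 + b^4 = c^4 + d^4"
  shows "\<not> a + b < c + d"
proof
  assume less: "a + b < c + d"
  define S where "S = c + d + a + b"
  define s where "s = c + d - a - b"
  define R where "R = a - b + (c - d)"
  define r where "r = a - b - (c - d)"
  define J where "J = 3 * r * R - s * S"
  define Q where "Q = r^2 + R^2"
  define D where "D = 8 * s * S - J"
  have fac: "D * Q = 3 * J * (S^2 + s^2)"
    unfolding D_def Q_def
    using fourth_powers_factorization[OF eq S_def s_def R_def r_def J_def] .
  have s_pos: "s > 0" using less by (simp add: s_def)
  have S_lower: "real_of_int S \<ge> 4 * N" using lo by (simp add: S_def)
  then have S_pos: "S > 0" using N by linarith
  have Q_nonneg: "Q \<ge> 0" by (simp add: Q_def)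
  have sum_pos: "S^2 + s^2 > 0" using s_pos by (simp add: add_nonneg_pos)

  \<comment> \<open>If \<open>J \<le> 0\<close>, the two sides of \<open>fac\<close> have opposite signs, so both vanish; then \<open>Q = 0\<close>
    makes the two differences \<open>a - b\<close> and \<open>c - d\<close> zero, against \<open>s * S > 0\<close>.\<close>
  have J_pos: "J > 0"
  proof (rule ccontr)
    assume "\<not> J > 0"
    then have J_le: "J \<le> 0" by simp
    have D_pos: "D > 0" using J_le s_pos S_pos mult_pos_pos[of s S] unfolding D_def by linarith
    have "D * Q \<le> 0"
      unfolding fac using J_le sum_pos by (simp add: mult_nonpos_nonneg)
    then have "Q = 0" using D_pos Q_nonneg by (simp add: mult_le_0_iff)
    then have "r = 0" by (simp add: Q_def sum_power2_eq_zero_iff)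
    moreover have "J = 0" using fac s_pos \<open>Q = 0\<close> by simp
    ultimately show False using s_pos S_pos by (simp add: J_def)
  qed
  have D_dvd: "D dvd 3 * J * (J^2 + 64 * s^4)"
    using eliminate_modulo_linear_factor fac unfolding D_def by blast
  have "3 * J * (J^2 + 64 * s^4) > 0"
    using J_pos s_pos by (intro mult_pos_pos add_pos_pos zero_less_power) auto
  with D_dvd have D_le: "D \<le> 3 * J * (J^2 + 64 * s^4)" by (rule zdvd_imp_le)

  \<comment> \<open>From here on sizes are compared, over the reals.\<close>
  define s' where "s' = real_of_int s"
  define S' where "S' = real_of_int S"
  define J' where "J' = real_of_int J"
  define Q' where "Q' = real_of_int Q"
  have pos': "s' > 0" "S' > 0" "J' > 0" "Q' \<ge> 0" "S' \<ge> 4 * N"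
    using s_pos S_pos J_pos Q_nonneg S_lower
    by (simp_all add: s'_def S'_def J'_def Q'_def)

  have square_le: "(real_of_int x - real_of_int y)^2 \<le> T * N"
    if "N \<le> x" "x \<le> N + H" "N \<le> y" "y \<le> N + H" for x y :: int
  proof -
    have "\<bar>real_of_int x - real_of_int y\<bar> \<le> H" using that by linarith
    then have "(real_of_int x - real_of_int y)^2 \<le> H^2"
      by (metis abs_ge_zero power2_abs power_mono)
    then show ?thesis using H by simp
  qed
  define U where "U = (real_of_int a - real_of_int b)^2"
  define V where "V = (real_of_int c - real_of_int d)^2"
  have U: "0 \<le> U" "U \<le> T * N" using square_le lo hi by (simp_all add: U_def)
  have V: "0 \<le> V" "V \<le> T * N" using square_le lo hi by (simp_all add: V_def)
  have Q'_eq: "Q' = 2 * (U + V)"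
    unfolding Q'_def Q_def r_def R_def U_def V_def by (simp add: power2_eq_square algebra_simps)
  have J'_eq: "J' = 3 * (U - V) - s' * S'"
    unfolding J'_def J_def r_def R_def U_def V_def s'_def S'_def
    by (simp add: power2_eq_square algebra_simps)

  \<comment> \<open>Positivity of \<open>J\<close> means \<open>s * S < 3 * (U - V)\<close>, where \<open>S\<close> is of order \<open>N\<close>.\<close>
  have s_bound: "s' \<le> 3/4 * T"
  proof -
    have "s' * (4 * N) \<le> s' * S'" using pos' by (intro mult_left_mono) auto
    also have "\<dots> = 3 * (U - V) - J'" using J'_eq by simp
    also have "\<dots> \<le> 3 * (T * N)" using pos'(3) U(2) V(1) by simp
    finally have "(4 * s') * N \<le> (3 * T) * N" by (simp add: algebra_simps)
    then show ?thesis using N by simp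
  qed
  \<comment> \<open>In \<open>fac\<close>, bound \<open>D\<close> from above by \<open>8 * s * S\<close> and \<open>S^2 + s^2\<close> from below by
    \<open>4 * N * S\<close>.\<close>
  have J_bound: "J' \<le> 8/3 * s' * T"
  proof -
    have fac': "(8 * s' * S' - J') * Q' = 3 * J' * (S'^2 + s'^2)"
      using arg_cong[OF fac, of real_of_int]
      by (simp add: D_def s'_def S'_def J'_def Q'_def)
    have "3 * J' * (4 * N) * S' \<le> 3 * J' * S' * S'"
      using pos' by (intro mult_right_mono) auto
    also have "\<dots> \<le> 3 * J' * (S'^2 + s'^2)"
      using pos' by (simp add: power2_eq_square algebra_simps)
    also have "\<dots> = (8 * s' * S' - J') * Q'" using fac' by simp
    also have "\<dots> \<le> 8 * s' * S' * Q'"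
      using pos' by (intro mult_right_mono) auto
    also have "\<dots> \<le> 8 * s' * S' * (4 * (T * N))"
      using pos' U V Q'_eq by (intro mult_left_mono) auto
    finally have "(12 * J') * (N * S') \<le> (32 * s' * T) * (N * S')"
      by (simp add: algebra_simps)
    then have "12 * J' \<le> 32 * s' * T"
      by (rule mult_right_le_imp_le) (use N pos' in simp)
    then show ?thesis by linarith
  qed

  have T_pos: "T > 0" using s_bound pos' by linarith
  have T_le: "T \<le> N"
  proof (rule ccontr)
    assume "\<not> T \<le> N"
    then have "T \<ge> 1" using N by linarith
    then have "T \<le> T^5" by (rule self_le_power) simp
    then show False using T \<open>\<not> T \<le> N\<close> N by linarith
  qed
  \<comment> \<open>Keeping a factor \<open>s'\<close> on both sides of the next chain allows it to be cancelled at the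
    end; what remains is an inequality between \<open>N\<close> and \<open>T^5\<close> alone.\<close>
  have "s' * (32 * N - 8/3 * T) \<le> 8 * s' * S' - J'"
  proof -
    have "s' * (4 * N) \<le> s' * S'" using pos' by (intro mult_left_mono) auto
    then show ?thesis using J_bound by (simp add: algebra_simps)
  qed
  also have "\<dots> \<le> 3 * J' * (J'^2 + 64 * s'^4)"
  proof -
    have "real_of_int D \<le> real_of_int (3 * J * (J^2 + 64 * s^4))"
      using D_le by (simp only: of_int_le_iff)
    then show ?thesis by (simp add: D_def s'_def S'_def J'_def)
  qed
  also have "\<dots> \<le> 3 * (8/3 * s' * T) * ((2 * T^2)^2 + 64 * (3/4 * T)^4)"
  proof -
    have "J' \<le> 8/3 * (3/4 * T) * T"
      using J_bound s_bound T_pos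
        mult_right_mono[of "8/3 * s'" "8/3 * (3/4 * T)" T] by linarith
    then have "J' \<le> 2 * T^2" by (simp add: power2_eq_square)
    then have "J'^2 + 64 * s'^4 \<le> (2 * T^2)^2 + 64 * (3/4 * T)^4"
      using pos' s_bound by (intro add_mono mult_left_mono power_mono) auto
    then show ?thesis using J_bound pos' T_pos by (intro mult_mono) auto
  qed
  also have "\<dots> = s' * (194 * T^5)"
    by (simp add: power_mult_distrib eval_nat_numeral algebra_simps)
  finally have "32 * N - 8/3 * T \<le> 194 * T^5" using pos' by simp
  then show False using T T_le N by linarith
qed

theorem theorem6:
  shows "\<exists>c::real. c > 0 \<and> (\<forall>N::nat. N > 0 \<longrightarrow>
    sidon {int n ^ 4 | n :: nat. n > 0 \<and> real N \<le> real n \<and>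
                                 real n \<le> real N + c * real N powr (3 / 5)})"
proof (intro exI[of _ "1/2"] conjI allI impI)
  show "(1/2 :: real) > 0" by simp
next
  fix N :: nat assume N: "N > 0"
  define H where "H = 1/2 * real N powr (3/5)"
  \<comment> \<open>This is \<open>H^2 / N\<close>.\<close>
  define T where "T = 1/4 * real N powr (1/5)"
  have T_pow: "1024 * T^5 \<le> real N"
  proof -
    have "(real N powr (1/5))^5 = real N"
      using N by (simp add: powr_power)
    then show ?thesis by (simp add: T_def power_mult_distrib power_divide)
  qed
  have H_sq: "H^2 \<le> T * real N"
  proof -
    have "(real N powr (3/5))^2 = real N powr (1/5) * real N"
      using N powr_add[of "real N" "1/5" 1] by (simp add: powr_power)
    then show ?thesis by (simp add: H_def T_def power_mult_distrib power_divide)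
  qed
  have not_less: "\<not> a + b < c + d"
    if "real N \<le> a" "real N \<le> b" "real N \<le> c" "real N \<le> d"
      "a \<le> real N + H" "b \<le> real N + H" "c \<le> real N + H" "d \<le> real N + H"
      "a^4 + b^4 = c^4 + d^4" for a b c d :: int
    using fourth_powers_short_interval_sum_not_less[OF _ _ T_pow H_sq that] N
    by (simp add: T_def)
  show "sidon {int n ^ 4 | n :: nat. n > 0 \<and> real N \<le> real n \<and>
                 real n \<le> real N + 1/2 * real N powr (3 / 5)}"
    unfolding sidon_def H_def[symmetric]
  proof (intro ballI impI, clarsimp)
    fix a b c d :: nat
    assume *: "N \<le> a" "N \<le> b" "N \<le> c" "N \<le> d" "real a \<le> real N + H" "real b \<le> real N + H"
      "real c \<le> real N + H" "real d \<le> real N + H"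
      and eq: "int a^4 + int b^4 = int c^4 + int d^4"
    have "int a + int b = int c + int d"
      using not_less[of "int a" "int b" "int c" "int d"]
        not_less[of "int c" "int d" "int a" "int b"] * eq by simp
    then have "{int a, int b} = {int c, int d}"
      using fourth_powers_equal_sum_trivial[OF eq] by simp
    then show "{int a^4, int b^4} = {int c^4, int d^4}"
      by (auto simp: doubleton_eq_iff)
  qed
qed

end
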